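(* Let $E\subset\mathbb{R}^n$ be finite, let $\mu\colon E\to\mathbb{T}$, and let $S(\mu)$ be the regular subdivision of $\mathrm{conv}(\supp(\mu))$ induced by $\mu$. Let $\mathcal{F}\subseteq\mathbb{T}[x_e\mid e\in E]$ be an affinely invariant set of tropical polynomials with trivial coefficients. If $\mu\in V^{\mathrm{trop}}(\mathcal{F})$, then for every cell $C\in S(\mu)$ the function $\mu_C\colon E\to\mathbb{T}$ defined by $\mu_C(e)=0$ if $e\in C$ and $\mu_C(e)=\infty$ otherwise satisfies $\mu_C\in V^{\mathrm{trop}}(\mathcal{F})$.
   Context: $\mathbb{T}=\mathbb{R}\cup\{\infty\}$ is the tropical semifield with $a\oplus b=\min(a,b)$ and $a\odot b=a+b$. A tropical polynomial with trivial coefficients is $f=\bigoplus_{\alpha\in A}x^{\odot\alpha}$ for a finite set $A\subseteq\mathbb{N}^E$. For $\nu\in\mathbb{T}^E$, $\nu\in V^{\mathrm{trop}}(f)$ means that either $f(\nu)=\infty$ or the minimum $f(\nu)=\min_\alpha\sum_e\alpha_e\nu(e)$ is attained by at least two distinct monomials; $V^{\mathrm{trop}}(\mathcal{F})=\bigcap_{f\in\mathcal{F}}V^{\mathrm{trop}}(f)$. $\supp(\mu)=\{e\in E:\mu(e)<\infty\}$, and $S(\mu)$ is the subdivision of $\mathrm{conv}(\supp\mu)$ obtained by projecting the lower faces of $\mathrm{conv}\{(e,\mu(e)) : e\in\supp\mu\}$; a cell $C$ is identified with the set of points of $E$ it contains (those lifted points lying on the corresponding lower face). A set $\mathcal{F}$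 of such tropical polynomials is affinely invariant if for every $\mu\colon E\to\mathbb{T}$ and every affine linear $\varphi\colon\mathbb{R}^n\to\mathbb{R}$, $\mu\in V^{\mathrm{trop}}(\mathcal{F})$ if and only if $\mu+\varphi|_E\in V^{\mathrm{trop}}(\mathcal{F})$. *)

theory Defs
  imports "HOL-Analysis.Analysis"
begin

(* The tropical semifield is realised inside ereal: tropical addition is min (so the empty
   tropical sum is \<infinity>), tropical multiplication is +. *)
definition trop :: "ereal set" where
  "trop = UNIV - {-\<infinity>}"

(* A tropical polynomial with trivial coefficients in the variables x_e, e in E, is given by the
   finite set A of its exponent vectors. Exponent vectors are extensional, so that distinct
   elements of A are distinct monomials. *)
definition trivial_trop_polys :: "'a set \<Rightarrow> ('a \<Rightarrow> nat) set set" where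
  "trivial_trop_polys E = {A. finite A \<and> A \<subseteq> E \<rightarrow>\<^sub>E UNIV}"

(* In ereal, 0 * \<infinity> = 0, as required for the 0-th tropical power. *)
definition trop_monomial :: "'a set \<Rightarrow> ('a \<Rightarrow> nat) \<Rightarrow> ('a \<Rightarrow> ereal) \<Rightarrow> ereal" where
  "trop_monomial E \<alpha> \<nu> = (\<Sum>e\<in>E. ereal (real (\<alpha> e)) * \<nu> e)"

definition trop_eval :: "'a set \<Rightarrow> ('a \<Rightarrow> nat) set \<Rightarrow> ('a \<Rightarrow> ereal) \<Rightarrow> ereal" where
  "trop_eval E A \<nu> = (INF \<alpha>\<in>A. trop_monomial E \<alpha> \<nu>)"

(* Points of the variety are functions whose values outside E are irrelevant. *)
definition trop_variety :: "'a set \<Rightarrow> ('a \<Rightarrow> nat) set set \<Rightarrow> ('a \<Rightarrow> ereal) set" where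
  "trop_variety E \<F> = {\<nu> \<in> E \<rightarrow> trop. \<forall>A\<in>\<F>.
     trop_eval E A \<nu> = \<infinity> \<or>
     (\<exists>\<alpha>\<in>A. \<exists>\<beta>\<in>A. \<alpha> \<noteq> \<beta> \<and> trop_monomial E \<alpha> \<nu> = trop_eval E A \<nu>
                       \<and> trop_monomial E \<beta> \<nu> = trop_eval E A \<nu>)}"

definition affine_linear :: "('a::real_vector \<Rightarrow> real) \<Rightarrow> bool" where
  "affine_linear \<phi> \<longleftrightarrow> (\<exists>L c. linear L \<and> \<phi> = (\<lambda>x. L x + c))"

definition affinely_invariant :: "'a::real_vector set \<Rightarrow> ('a \<Rightarrow> nat) set set \<Rightarrow> bool" where
  "affinely_invariant E \<F> \<longleftrightarrow>
     (\<forall>\<mu> \<in> E \<rightarrow> trop. \<forall>\<phi>. affine_linear \<phi> \<longrightarrow>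
        (\<mu> \<in> trop_variety E \<F> \<longleftrightarrow> (\<lambda>e. \<mu> e + ereal (\<phi> e)) \<in> trop_variety E \<F>))"

definition trop_supp :: "'a set \<Rightarrow> ('a \<Rightarrow> ereal) \<Rightarrow> 'a set" where
  "trop_supp E \<mu> = {e \<in> E. \<mu> e < \<infinity>}"

definition lifted_point :: "('a \<Rightarrow> ereal) \<Rightarrow> 'a \<Rightarrow> 'a \<times> real" where
  "lifted_point \<mu> e = (e, real_of_ereal (\<mu> e))"

definition lifted_polytope :: "'a::euclidean_space set \<Rightarrow> ('a \<Rightarrow> ereal) \<Rightarrow> ('a \<times> real) set" where
  "lifted_polytope E \<mu> = convex hull (lifted_point \<mu> ` trop_supp E \<mu>)"

(* Faces exposed by a supporting hyperplane whose outer normal (a, h) points downwards.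
   As for face_of and exposed_face_of, the empty set counts as a face. *)
definition lower_face_of ::
    "('a::euclidean_space \<times> real) set \<Rightarrow> ('a \<times> real) set \<Rightarrow> bool" (infixr "lower'_face'_of" 50) where
  "F lower_face_of P \<longleftrightarrow> F face_of P \<and>
     (\<exists>a h b. h < 0 \<and> P \<subseteq> {x. (a, h) \<bullet> x \<le> b} \<and> F = P \<inter> {x. (a, h) \<bullet> x = b})"

(* The cell fst ` F is identified with the set of points of E whose lifts lie on F; a point of E
   that lies in fst ` F but is lifted above F does not belong to the cell. *)
definition regular_subdivision :: "'a::euclidean_space set \<Rightarrow> ('a \<Rightarrow> ereal) \<Rightarrow> 'a set set" where
  "regular_subdivision E \<mu> =
     {{e \<in> trop_supp E \<mu>. lifted_point \<mu> e \<in> F} | F. F lower_face_of lifted_polytope E \<mu>}"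

definition cell_function :: "'a set \<Rightarrow> 'a \<Rightarrow> ereal" where
  "cell_function C e = (if e \<in> C then 0 else \<infinity>)"

end

(* Tilting by the affine function supporting the cell C replaces \<mu> by a point \<nu> \<ge> 0 of the variety
   whose zero set in E is exactly C. Since all coefficients are trivial, a monomial vanishes at \<nu>
   iff it only involves variables from C, iff it vanishes at cell_function C; every other monomial
   is \<infinity> at cell_function C. So a minimum of 0 attained twice at \<nu> is also attained twice there. *)
theory Submission
  imports Defs
begin

lemma trop_monomial_nonneg:
  assumes "\<And>e. e \<in> E \<Longrightarrow> 0 \<le> \<nu> e"
  shows "0 \<le> trop_monomial E \<alpha> \<nu>"
  unfolding trop_monomial_def by (intro sum_nonneg) (simp add: assms)

text \<open>Nonnegative summands cannot cancel, so the sum vanishes only when every product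
  does.\<close>

lemma trop_monomial_eq_0_iff:
  assumes "finite E" and "\<And>e. e \<in> E \<Longrightarrow> 0 \<le> \<nu> e"
  shows "trop_monomial E \<alpha> \<nu> = 0 \<longleftrightarrow> (\<forall>e\<in>E. \<alpha> e = 0 \<or> \<nu> e = 0)"
  unfolding trop_monomial_def
  by (subst sum_nonneg_eq_0_iff) (auto simp: assms)

text \<open>The convention \<open>0 * \<infinity> = 0\<close> makes variables with exponent 0
  harmless, while a single positive exponent outside \<open>C\<close> forces the whole sum to be
  infinite.\<close>

lemma trop_monomial_cell_function:
  assumes "finite E"
  shows "trop_monomial E \<alpha> (cell_function C) = (if \<forall>e\<in>E - C. \<alpha> e = 0 then 0 else \<infinity>)"
proof (cases "\<forall>e\<in>E - C. \<alpha> e = 0")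
  case True
  then show ?thesis
    using assms by (subst trop_monomial_eq_0_iff[THEN iffD2]) (auto simp: cell_function_def)
next
  case False
  then obtain e where "e \<in> E" "e \<notin> C" "\<alpha> e \<noteq> 0"
    by auto
  then have "ereal (real (\<alpha> e)) * cell_function C e = \<infinity>"
    by (simp add: cell_function_def)
  with \<open>e \<in> E\<close> assms have "trop_monomial E \<alpha> (cell_function C) = \<infinity>"
    unfolding trop_monomial_def sum_Pinfty by blast
  with False show ?thesis
    by simp
qed

lemma trop_eval_eq_0:
  assumes "\<And>e. e \<in> E \<Longrightarrow> 0 \<le> \<nu> e" and "\<alpha> \<in> A" and "trop_monomial E \<alpha> \<nu> = 0"
  shows "trop_eval E A \<nu> = 0"
  unfolding trop_eval_def
proof (rule antisym)
  show "(INF \<alpha>\<in>A. trop_monomial E \<alpha> \<nu>) \<le> 0"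
    using assms(2,3) by (metis INF_lower)
  show "0 \<le> (INF \<alpha>\<in>A. trop_monomial E \<alpha> \<nu>)"
    by (intro INF_greatest trop_monomial_nonneg assms(1))
qed

lemma cell_function_zero_set_in_trop_variety:
  assumes fin: "finite E" and nonneg: "\<And>e. e \<in> E \<Longrightarrow> 0 \<le> \<nu> e"
    and zero: "\<And>e. e \<in> E \<Longrightarrow> \<nu> e = 0 \<longleftrightarrow> e \<in> C"
    and \<nu>: "\<nu> \<in> trop_variety E \<F>"
  shows "cell_function C \<in> trop_variety E \<F>"
proof -
  have cell_nonneg: "0 \<le> cell_function C e" for e
    by (simp add: cell_function_def)
  have same: "trop_monomial E \<alpha> \<nu> = 0 \<longleftrightarrow> trop_monomial E \<alpha> (cell_function C) = 0" for \<alpha>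
    using zero
    by (auto simp: trop_monomial_eq_0_iff[OF fin nonneg] trop_monomial_cell_function[OF fin])
  have "trop_eval E A (cell_function C) = \<infinity> \<or>
     (\<exists>\<alpha>\<in>A. \<exists>\<beta>\<in>A. \<alpha> \<noteq> \<beta> \<and> trop_monomial E \<alpha> (cell_function C) = trop_eval E A (cell_function C)
        \<and> trop_monomial E \<beta> (cell_function C) = trop_eval E A (cell_function C))"
    if "A \<in> \<F>" for A
  \<comment> \<open>Every monomial is 0 or \<infinity> at \<open>cell_function C\<close>, so if none
    is 0 the minimum is \<infinity>; this includes the case of empty \<open>A\<close>.\<close>
  proof (cases "\<exists>\<gamma>\<in>A. trop_monomial E \<gamma> (cell_function C) = 0")
    case True
    then obtain \<gamma> where \<gamma>: "\<gamma> \<in> A" "trop_monomial E \<gamma> (cell_function C) = 0"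
      by blast
    have eval_\<nu>: "trop_eval E A \<nu> = 0"
      using trop_eval_eq_0[of E \<nu> \<gamma> A] nonneg \<gamma> same by blast
    have eval_cell: "trop_eval E A (cell_function C) = 0"
      using trop_eval_eq_0[of E "cell_function C" \<gamma> A] cell_nonneg \<gamma> by blast
    \<comment> \<open>The value 0 excludes the alternative
      \<open>trop_eval E A \<nu> = \<infinity>\<close>, so the minimum at \<open>\<nu>\<close> is
      attained twice.\<close>
    obtain \<alpha> \<beta> where "\<alpha> \<in> A" "\<beta> \<in> A" "\<alpha> \<noteq> \<beta>"
      "trop_monomial E \<alpha> \<nu> = 0" "trop_monomial E \<beta> \<nu> = 0"
      using \<nu> \<open>A \<in> \<F>\<close> eval_\<nu> unfolding trop_variety_def by fastforce
    then show ?thesis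
      unfolding eval_cell same by blast
  next
    case False
    then have "trop_monomial E \<alpha> (cell_function C) = \<infinity>" if "\<alpha> \<in> A" for \<alpha>
      using that by (metis trop_monomial_cell_function[OF fin])
    then have "\<infinity> \<le> trop_eval E A (cell_function C)"
      unfolding trop_eval_def by (intro INF_greatest) simp
    then show ?thesis
      by simp
  qed
  moreover have "cell_function C \<in> E \<rightarrow> trop"
    by (auto simp: cell_function_def trop_def)
  ultimately show ?thesis
    by (simp add: trop_variety_def)
qed

text \<open>The graph of \<open>- \<phi>\<close> is the hyperplane exposing the lower face, so the
  tilted value is the vertical height of a lifted point above that hyperplane. The polytope lies on
  or above it and meets it exactly in the face.\<close>

lemma regular_subdivision_affine_tilt:
  assumes \<mu>: "\<mu> \<in> E \<rightarrow> trop" and C: "C \<in> regular_subdivision E \<mu>"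
  obtains \<phi> where "affine_linear \<phi>"
    and "\<And>e. e \<in> E \<Longrightarrow> 0 \<le> \<mu> e + ereal (\<phi> e)"
    and "\<And>e. e \<in> E \<Longrightarrow> \<mu> e + ereal (\<phi> e) = 0 \<longleftrightarrow> e \<in> C"
proof -
  obtain a h b where h: "h < 0"
    and sub: "lifted_polytope E \<mu> \<subseteq> {x. (a, h) \<bullet> x \<le> b}"
    and C_eq: "C = {e \<in> trop_supp E \<mu>.
      lifted_point \<mu> e \<in> lifted_polytope E \<mu> \<inter> {x. (a, h) \<bullet> x = b}}"
    using C unfolding regular_subdivision_def lower_face_of_def by blast
  \<comment> \<open>Solving \<open>(a, h) \<bullet> (x, t) = b\<close> for \<open>t\<close> gives
    \<open>t = - \<phi> x\<close>.\<close>
  define \<phi> where "\<phi> x = (a \<bullet> x - b) / h" for x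
  have "linear (\<lambda>x. a \<bullet> x / h)"
    by (auto intro!: linearI simp: inner_add_right add_divide_distrib)
  moreover have "\<phi> = (\<lambda>x. a \<bullet> x / h + (- b / h))"
    by (auto simp: \<phi>_def diff_divide_distrib)
  ultimately have "affine_linear \<phi>"
    unfolding affine_linear_def by blast
  moreover have "0 \<le> \<mu> e + ereal (\<phi> e) \<and> (\<mu> e + ereal (\<phi> e) = 0 \<longleftrightarrow> e \<in> C)"
    if e: "e \<in> E" for e
  proof (cases "\<mu> e")
    case (real r)
    have lift: "lifted_point \<mu> e = (e, r)"
      by (simp add: lifted_point_def real)
    have supp: "e \<in> trop_supp E \<mu>"
      using e real by (simp add: trop_supp_def)
    then have hull: "lifted_point \<mu> e \<in> lifted_polytope E \<mu>"
      unfolding lifted_polytope_def by (intro hull_inc imageI)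
    then have "a \<bullet> e + h * r \<le> b"
      using sub lift by auto
    \<comment> \<open>Cells are defined through lifts: a point of \<open>E\<close> over the face but
      lifted above it is outside \<open>C\<close>, in accordance with its positive tilted
      value.\<close>
    moreover have "e \<in> C \<longleftrightarrow> a \<bullet> e + h * r = b"
      using supp hull lift by (simp add: C_eq)
    \<comment> \<open>Division by the negative \<open>h\<close> reverses the supporting inequality
      and gives nonnegativity.\<close>
    moreover have "r + \<phi> e = (a \<bullet> e + h * r - b) / h"
      using h by (simp add: \<phi>_def field_simps)
    ultimately show ?thesis
      using h real by (simp add: zero_le_divide_iff)
  next
    \<comment> \<open>Off the support the tilted value stays infinite, hence nonzero, and cells
      contain only points of the support.\<close>
    case PInf
    then show ?thesis
      by (simp add: C_eq trop_supp_def)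
  next
    case MInf
    with \<mu> e show ?thesis
      by (auto simp: trop_def Pi_iff)
  qed
  ultimately show thesis
    using that by blast
qed

theorem theorem3p3:
  fixes E :: "(real ^ 'n) set"
    and \<mu> :: "real ^ 'n \<Rightarrow> ereal"
    and \<F> :: "(real ^ 'n \<Rightarrow> nat) set set"
  assumes "finite E"
    and "\<mu> \<in> E \<rightarrow> trop"
    and "\<F> \<subseteq> trivial_trop_polys E"
    and "affinely_invariant E \<F>"
    and "\<mu> \<in> trop_variety E \<F>"
  shows "\<forall>C \<in> regular_subdivision E \<mu>. cell_function C \<in> trop_variety E \<F>"
proof
  fix C
  assume C: "C \<in> regular_subdivision E \<mu>"
  obtain \<phi> where "affine_linear \<phi>"
    and tilt: "\<And>e. e \<in> E \<Longrightarrow> 0 \<le> \<mu> e + ereal (\<phi> e)"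
      "\<And>e. e \<in> E \<Longrightarrow> \<mu> e + ereal (\<phi> e) = 0 \<longleftrightarrow> e \<in> C"
    using regular_subdivision_affine_tilt[OF assms(2) C] by metis
  then have "(\<lambda>e. \<mu> e + ereal (\<phi> e)) \<in> trop_variety E \<F>"
    using assms(2,4,5) unfolding affinely_invariant_def by blast
  with assms(1) tilt show "cell_function C \<in> trop_variety E \<F>"
    by (intro cell_function_zero_set_in_trop_variety[where \<nu> = "\<lambda>e. \<mu> e + ereal (\<phi> e)"])
qed

end
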